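(* Let $m \ge 1$ be an integer and let $K_{m,m}$ be the balanced complete bipartite graph on $2m$ vertices. Then $\mathrm{s}[K_{m,m}^\circ, 2] = 2m-1$ and $\mathrm{s}_+[K_{m,m}^\circ, 2] = m$.
   Context: Graphs are finite and directed. $K_{m,m}$ has vertex set $V=L\cup R$ with $L=\{l_1,\dots,l_m\}$, $R=\{r_1,\dots,r_m\}$ disjoint, and its arcs are all $(l_i,r_j)$ and all $(r_j,l_i)$, $1\le i,j\le m$. For a loopless graph $D$, $D^\circ$ is obtained from $D$ by adding a loop $(v,v)$ on every vertex. Let $n$ be the number of vertices and index coordinates of $[2]^n=\{0,1\}^n$ by the vertices. For $f=(f_v)_{v\in V}:[2]^n\to[2]^n$, the interaction graph $G(f)$ has vertex set $V$ and an arc $(u,v)$ if and only if there exist $x,y\in[2]^n$ differing only in coordinate $u$ with $f_v(x)\ne f_v(y)$. $\mathrm{F}[H,2]$ is the set of all $f:[2]^n\to[2]^n$ with $G(f)=H$, and $\mathrm{F}_+[H,2]$ is the subset of those $f$ that are monotone, i.e. $x\le y$ coordinatewise implies $f(x)\le f(y)$ coordinatewise. With $d_{\mathrm H}$ the Hamming distance, $\mathrm{s}(f)=\min_{x\in[2]^n}(n-d_{\mathrm H}(x,f(x)))$, $\mathrm{s}[H,2]=\max_{f\in\mathrm{F}[H,2]}\mathrm{s}(f)$ and $\mathrm{s}_+[H,2]=\max_{f\in\mathrm{F}_+[H,2]}\mathrm{s}(f)$. *)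

theory Defs
  imports "Graph_Theory.Graph_Theory" "HOL-Library.FuncSet"
begin

definition add_loops :: "'v pair_pre_digraph \<Rightarrow> 'v pair_pre_digraph" where
  "add_loops D = \<lparr> pverts = pverts D, parcs = parcs D \<union> Id_on (pverts D) \<rparr>"

(* The configurations [q]^V, with [q] = {0,...,q-1}. Being extensional, configurations take the
   value undefined outside V, so that equality and the order on functions are those of [q]^V. *)
definition configs :: "'v set \<Rightarrow> nat \<Rightarrow> ('v \<Rightarrow> nat) set" where
  "configs V q = V \<rightarrow>\<^sub>E {..<q}"

definition interaction_graph ::
    "'v set \<Rightarrow> nat \<Rightarrow> (('v \<Rightarrow> nat) \<Rightarrow> ('v \<Rightarrow> nat)) \<Rightarrow> 'v pair_pre_digraph" where
  "interaction_graph V q f = \<lparr> pverts = V,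
     parcs = {(u, v). u \<in> V \<and> v \<in> V \<and>
       (\<exists>x \<in> configs V q. \<exists>y \<in> configs V q. {w \<in> V. x w \<noteq> y w} = {u} \<and> f x v \<noteq> f y v)} \<rparr>"

definition networks :: "'v pair_pre_digraph \<Rightarrow> nat \<Rightarrow> (('v \<Rightarrow> nat) \<Rightarrow> ('v \<Rightarrow> nat)) set" where
  "networks H q = {f \<in> configs (pverts H) q \<rightarrow>\<^sub>E configs (pverts H) q.
     interaction_graph (pverts H) q f = H}"

definition monotone_networks ::
    "'v pair_pre_digraph \<Rightarrow> nat \<Rightarrow> (('v \<Rightarrow> nat) \<Rightarrow> ('v \<Rightarrow> nat)) set" where
  "monotone_networks H q = {f \<in> networks H q. mono_on (configs (pverts H) q) f}"

definition hamming_dist :: "'v set \<Rightarrow> ('v \<Rightarrow> nat) \<Rightarrow> ('v \<Rightarrow> nat) \<Rightarrow> nat" where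
  "hamming_dist V x y = card {v \<in> V. x v \<noteq> y v}"

(* For finite V the Hamming distance is at most card V, so the subtraction does not truncate. *)
definition stability :: "'v set \<Rightarrow> nat \<Rightarrow> (('v \<Rightarrow> nat) \<Rightarrow> ('v \<Rightarrow> nat)) \<Rightarrow> nat" where
  "stability V q f = Min ((\<lambda>x. card V - hamming_dist V x (f x)) ` configs V q)"

(* Networks are extensional on the finite set of configurations, so for a finite graph the
   maxima below range over finite sets. *)
definition max_stability :: "'v pair_pre_digraph \<Rightarrow> nat \<Rightarrow> nat" where
  "max_stability H q = Max (stability (pverts H) q ` networks H q)"

definition max_monotone_stability :: "'v pair_pre_digraph \<Rightarrow> nat \<Rightarrow> nat" where
  "max_monotone_stability H q = Max (stability (pverts H) q ` monotone_networks H q)"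

end

theory Submission
  imports Defs
begin

text \<open>
  Write \<open>1\<^sub>A\<close> for the configuration that is 1 exactly on \<open>A\<close>, and fix a bijection \<open>h\<close> from \<open>L\<close> to \<open>R\<close>.

  The identity does not have interaction graph \<open>K\<^sub>m\<^sub>,\<^sub>m\<close> with loops, so stability \<open>2m\<close> is impossible.
  Stability \<open>2m - 1\<close> is reached by the network that only ever turns a 0 into a 1, at \<open>l \<in> L\<close> when
  \<open>x\<close> restricted to \<open>R\<close> is the indicator of \<open>h l\<close>, and at \<open>r \<in> R\<close> when \<open>x\<close> restricted to \<open>L\<close> is the
  complement of the indicator of the preimage of \<open>r\<close>. Two vertices on the same side have different
  patterns; if \<open>l\<close> and \<open>r\<close> both changed, then \<open>x l = 0\<close> would give \<open>h l = r\<close>, and \<open>x r = 0\<close> would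
  give \<open>h l \<noteq> r\<close>.

  In a monotone network \<open>f\<close>, a vertex \<open>v \<in> L\<close> that is fixed both at \<open>1\<^sub>L\<close> and at \<open>1\<^sub>R\<close> satisfies
  \<open>f x v = x v\<close> for all \<open>x\<close>, because \<open>f x v\<close> depends only on \<open>x v\<close> and on \<open>x\<close> restricted to \<open>R\<close>; this
  contradicts its dependence on \<open>R\<close>. Symmetrically for \<open>R\<close>. Hence each of the \<open>2m\<close> vertices changes
  at \<open>1\<^sub>L\<close> or at \<open>1\<^sub>R\<close>, and one of the two configurations has at least \<open>m\<close> changes. The bound \<open>m\<close> is
  reached by the conjunction of \<open>x l\<close> with all of \<open>R\<close>, and of \<open>x r\<close> with the disjunction of \<open>L\<close>:
  the first changes something only if \<open>x\<close> is nonzero on \<open>L\<close>, the second only if it is zero there.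
\<close>

section \<open>Configurations and stability\<close>

lemma finite_configs: "finite V \<Longrightarrow> finite (configs V q)"
  unfolding configs_def by (auto intro: finite_PiE)

lemma finite_networks:
  assumes "finite (pverts H)"
  shows "finite (networks H q)"
  using finite_PiE[OF finite_configs finite_configs, OF assms assms]
  by (auto simp: networks_def intro: rev_finite_subset)

definition indicator_config :: "'v set \<Rightarrow> 'v set \<Rightarrow> 'v \<Rightarrow> nat" where
  "indicator_config V A = (\<lambda>w\<in>V. of_bool (w \<in> A))"

lemma indicator_config_in_configs: "indicator_config V A \<in> configs V 2"
  by (auto simp: indicator_config_def configs_def)

lemma indicator_config_apply: "w \<in> V \<Longrightarrow> indicator_config V A w = of_bool (w \<in> A)"
  by (simp add: indicator_config_def)

lemma configs_2_cases:
  assumes "x \<in> configs V 2" "v \<in> V"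
  shows "x v = 0 \<or> x v = 1"
  using assms by (auto simp: configs_def PiE_iff less_2_cases_iff)

lemma flip_in_configs:
  assumes "x \<in> configs V 2" "u \<in> V"
  shows "x(u := 1 - x u) \<in> configs V 2"
  using assms by (auto simp: configs_def PiE_iff extensional_def)

lemma stability_le:
  assumes "finite V" "x \<in> configs V q"
  shows "stability V q f \<le> card V - hamming_dist V x (f x)"
  unfolding stability_def using assms by (intro Min_le) (auto simp: finite_configs)

lemma stability_ge:
  assumes "finite V" "\<And>x. x \<in> configs V 2 \<Longrightarrow> k \<le> card V - hamming_dist V x (f x)"
  shows "k \<le> stability V 2 f"
  unfolding stability_def
  \<comment> \<open>\<open>Min_ge_iff\<close> needs a nonempty set; the zero configuration supplies
    an element.\<close>
  using assms indicator_config_in_configs[of V "{}"]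
  by (subst Min_ge_iff) (auto simp: finite_configs)

section \<open>Networks and their interaction graphs\<close>

definition bool_network ::
    "'v set \<Rightarrow> (('v \<Rightarrow> nat) \<Rightarrow> 'v \<Rightarrow> bool) \<Rightarrow> ('v \<Rightarrow> nat) \<Rightarrow> 'v \<Rightarrow> nat" where
  "bool_network V F = (\<lambda>x\<in>configs V 2. \<lambda>v\<in>V. of_bool (F x v))"

lemma bool_network_apply:
  "x \<in> configs V 2 \<Longrightarrow> v \<in> V \<Longrightarrow> bool_network V F x v = of_bool (F x v)"
  by (simp add: bool_network_def)

text \<open>\<open>loc\<close> rules out extra arcs: if \<open>x\<close> and \<open>y\<close> differ
  only in \<open>u\<close> and the value at \<open>v\<close> changes, then some in-neighbour of
  \<open>v\<close> differs, and it must be \<open>u\<close>. \<open>dep\<close> realises each arc of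
  \<open>H\<close> by one flip.\<close>

lemma bool_network_in_networks:
  assumes sub: "parcs H \<subseteq> pverts H \<times> pverts H"
    and loc: "\<And>x y v. v \<in> pverts H \<Longrightarrow> (\<And>u. (u, v) \<in> parcs H \<Longrightarrow> x u = y u) \<Longrightarrow> F x v = F y v"
    and dep: "\<And>u v. (u, v) \<in> parcs H \<Longrightarrow>
      \<exists>x \<in> configs (pverts H) 2. F x v \<noteq> F (x(u := 1 - x u)) v"
  shows "bool_network (pverts H) F \<in> networks H 2"
proof -
  let ?V = "pverts H"
  let ?I = "interaction_graph ?V 2 (bool_network ?V F)"
  have "(u, v) \<in> parcs ?I \<longleftrightarrow> (u, v) \<in> parcs H" for u v
  proof
    assume "(u, v) \<in> parcs ?I"
    then obtain x y where uv: "u \<in> ?V" "v \<in> ?V"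
      and xy: "x \<in> configs ?V 2" "y \<in> configs ?V 2" "{w \<in> ?V. x w \<noteq> y w} = {u}"
      and ne: "bool_network ?V F x v \<noteq> bool_network ?V F y v"
      by (auto simp: interaction_graph_def)
    have "F x v \<noteq> F y v"
      using ne uv xy by (auto simp: bool_network_apply)
    then obtain w where "(w, v) \<in> parcs H" "x w \<noteq> y w"
      using loc[of v x y] uv by blast
    moreover from this have "w \<in> {w \<in> ?V. x w \<noteq> y w}"
      using sub by auto
    then have "w = u"
      unfolding xy(3) by simp
    ultimately show "(u, v) \<in> parcs H"
      by simp
  next
    assume uv: "(u, v) \<in> parcs H"
    then obtain x where x: "x \<in> configs ?V 2" "F x v \<noteq> F (x(u := 1 - x u)) v"
      using dep by blast
    have V: "u \<in> ?V" "v \<in> ?V"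
      using uv sub by auto
    let ?y = "x(u := 1 - x u)"
    have "?y \<in> configs ?V 2"
      using x V by (intro flip_in_configs)
    moreover have "{w \<in> ?V. x w \<noteq> ?y w} = {u}"
      using configs_2_cases[OF x(1) V(1)] V by auto
    moreover have "bool_network ?V F x v \<noteq> bool_network ?V F ?y v"
      using x V \<open>?y \<in> configs ?V 2\<close> by (simp add: bool_network_apply)
    ultimately have "\<exists>x \<in> configs ?V 2. \<exists>y \<in> configs ?V 2.
        {w \<in> ?V. x w \<noteq> y w} = {u} \<and> bool_network ?V F x v \<noteq> bool_network ?V F y v"
      by (intro bexI[of _ x] bexI[of _ ?y] conjI x(1))
    then show "(u, v) \<in> parcs ?I"
      unfolding interaction_graph_def using V by simp
  qed
  then have "parcs ?I = parcs H"
    by auto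
  then have "?I = H"
    by (intro pair_pre_digraph.equality) (simp_all add: interaction_graph_def)
  then show ?thesis
    by (auto simp: networks_def bool_network_def configs_def)
qed

text \<open>The graph only speaks of single-coordinate changes; turning \<open>x\<close> into
  \<open>y\<close> one coordinate at a time extends this to arbitrary pairs.\<close>

lemma network_local:
  assumes f: "f \<in> networks H q"
    and xy: "x \<in> configs (pverts H) q" "y \<in> configs (pverts H) q"
    and fin: "finite (pverts H)" and v: "v \<in> pverts H"
    and eq: "\<And>u. (u, v) \<in> parcs H \<Longrightarrow> x u = y u"
  shows "f x v = f y v"
proof -
  let ?V = "pverts H"
  have arc: "(u, v) \<in> parcs H"
    if "u \<in> ?V" "x \<in> configs ?V q" "y \<in> configs ?V q" "{w \<in> ?V. x w \<noteq> y w} = {u}" "f x v \<noteq> f y v"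
    for u x y
  proof -
    have "(u, v) \<in> parcs (interaction_graph ?V q f)"
      unfolding interaction_graph_def using that v by auto
    then show ?thesis
      using f by (simp add: networks_def)
  qed
  have "finite {w \<in> ?V. x w \<noteq> y w}"
    using fin by simp
  then show ?thesis
    using xy eq
  proof (induction "{w \<in> ?V. x w \<noteq> y w}" arbitrary: x rule: finite_psubset_induct)
    case (psubset x)
    show ?case
    proof (cases "{w \<in> ?V. x w \<noteq> y w} = {}")
      case True
      then have "x = y"
        using psubset.prems unfolding configs_def by (intro PiE_ext) auto
      then show ?thesis by simp
    next
      case False
      then obtain u where u: "u \<in> ?V" "x u \<noteq> y u" by auto
      \<comment> \<open>One coordinate closer to \<open>y\<close>. As \<open>x\<close> and
        \<open>y\<close> agree on the in-neighbours of \<open>v\<close>, \<open>u\<close> is not one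
        of them.\<close>
      let ?z = "x(u := y u)"
      have z: "?z \<in> configs ?V q"
        using psubset.prems u by (auto simp: configs_def PiE_iff extensional_def)
      have "f ?z v = f y v"
        using psubset.prems u z by (intro psubset.hyps(2)) auto
      moreover have "f x v = f ?z v"
      proof (rule ccontr)
        assume ne: "f x v \<noteq> f ?z v"
        have "{w \<in> ?V. x w \<noteq> ?z w} = {u}"
          using u by auto
        then have "(u, v) \<in> parcs H"
          using arc u(1) psubset.prems(1) z ne by blast
        then show False
          using psubset.prems(3) u by blast
      qed
      ultimately show ?thesis by simp
    qed
  qed
qed

section \<open>Networks attaining the bounds\<close>

definition looped_bipartite :: "'v set \<Rightarrow> 'v set \<Rightarrow> 'v pair_pre_digraph" where
  "looped_bipartite L R =
    \<lparr> pverts = L \<union> R, parcs = L \<times> R \<union> R \<times> L \<union> Id_on (L \<union> R) \<rparr>"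

lemma looped_bipartite_simps [simp]:
  "pverts (looped_bipartite L R) = L \<union> R"
  "parcs (looped_bipartite L R) = L \<times> R \<union> R \<times> L \<union> Id_on (L \<union> R)"
  by (simp_all add: looped_bipartite_def)

lemma looped_bipartite_commute: "looped_bipartite L R = looped_bipartite R L"
  by (auto simp: looped_bipartite_def)

lemma ex_stable_network:
  assumes fin: "finite L" "finite R" and disj: "L \<inter> R = {}" and h: "bij_betw h L R"
  shows "\<exists>f \<in> networks (looped_bipartite L R) 2.
    card (L \<union> R) - 1 \<le> stability (L \<union> R) 2 f"
proof -
  let ?V = "L \<union> R"
  define F :: "('a \<Rightarrow> nat) \<Rightarrow> 'a \<Rightarrow> bool" where
    "F x v \<longleftrightarrow> x v = 1 \<or>
      (if v \<in> L then \<forall>r\<in>R. x r = of_bool (r = h v) else \<forall>l\<in>L. x l = of_bool (h l \<noteq> v))"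
    for x v
  have hR: "h l \<in> R" "h l \<notin> L" if "l \<in> L" for l
    using h that disj by (auto simp: bij_betw_def)
  have "bool_network (pverts (looped_bipartite L R)) F \<in> networks (looped_bipartite L R) 2"
  proof (rule bool_network_in_networks)
    fix x y :: "'a \<Rightarrow> nat" and v
    assume v: "v \<in> pverts (looped_bipartite L R)"
      and eq: "\<And>u. (u, v) \<in> parcs (looped_bipartite L R) \<Longrightarrow> x u = y u"
    have "x v = y v" "v \<in> L \<Longrightarrow> \<forall>r\<in>R. x r = y r" "v \<notin> L \<Longrightarrow> \<forall>l\<in>L. x l = y l"
      using v eq by auto
    then show "F x v = F y v"
      by (auto simp: F_def)
  next
    fix u v
    assume "(u, v) \<in> parcs (looped_bipartite L R)"
    then consider "v \<in> L" "u \<in> R" | "v \<in> L" "u = v" | "v \<in> R" "u \<in> L" | "v \<in> R" "u = v"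
      by auto
    then show "\<exists>x \<in> configs (pverts (looped_bipartite L R)) 2. F x v \<noteq> F (x(u := 1 - x u)) v"
    proof cases
      case 1
      \<comment> \<open>The pattern of \<open>v\<close> holds on \<open>R\<close> and
        \<open>v\<close> is 0, so any flip in \<open>R\<close> switches \<open>v\<close>
        off.\<close>
      let ?x = "indicator_config ?V {h v}"
      have "F ?x v"
        using 1 by (auto simp: F_def indicator_config_apply)
      moreover have "\<not> F (?x(u := 1 - ?x u)) v"
        using 1 hR[of v] disj by (auto simp: F_def indicator_config_apply)
      ultimately show ?thesis
        by (intro bexI[of _ ?x]) (auto simp: indicator_config_in_configs)
    next
      case 2
      \<comment> \<open>The pattern fails at \<open>h v\<close>, so only the loop can switch
        \<open>v\<close> on.\<close>
      let ?x = "indicator_config ?V {}"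
      have "\<not> F ?x v"
        using 2 hR[of v] by (auto simp: F_def indicator_config_apply)
      moreover have "F (?x(u := 1 - ?x u)) v"
        using 2 by (auto simp: F_def indicator_config_apply)
      ultimately show ?thesis
        by (intro bexI[of _ ?x]) (auto simp: indicator_config_in_configs)
    next
      case 3
      \<comment> \<open>Again the pattern of \<open>v\<close> is met, now on \<open>L\<close>, and
        any flip there breaks it.\<close>
      let ?x = "indicator_config ?V {l \<in> L. h l \<noteq> v}"
      have "v \<notin> L"
        using 3 disj by auto
      then have "F ?x v" "\<not> F (?x(u := 1 - ?x u)) v"
        using 3 by (auto simp: F_def indicator_config_apply)
      then show ?thesis
        by (intro bexI[of _ ?x]) (auto simp: indicator_config_in_configs)
    next
      case 4
      \<comment> \<open>The pattern fails at the preimage of \<open>v\<close>, where it demands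
        0.\<close>
      let ?x = "indicator_config ?V L"
      have "v \<notin> L"
        using 4 disj by auto
      moreover obtain l where "l \<in> L" "h l = v"
        using 4 h by (auto simp: bij_betw_def)
      ultimately have "\<not> F ?x v" "F (?x(u := 1 - ?x u)) v"
        using 4 by (auto simp: F_def indicator_config_apply)
      then show ?thesis
        by (intro bexI[of _ ?x]) (auto simp: indicator_config_in_configs)
    qed
  qed auto
  moreover have "card ?V - 1 \<le> stability ?V 2 (bool_network ?V F)"
  proof (rule stability_ge)
    fix x assume x: "x \<in> configs ?V 2"
    have zero: "x v = 0" "F x v" if "v \<in> ?V" "x v \<noteq> bool_network ?V F x v" for v
      using that x configs_2_cases[OF x that(1)] by (auto simp: bool_network_apply F_def)
    have L: "\<forall>r\<in>R. x r = of_bool (r = h v)" if "v \<in> L" "x v = 0" "F x v" for v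
      using that by (auto simp: F_def)
    have R: "\<forall>l\<in>L. x l = of_bool (h l \<noteq> v)" if "v \<in> R" "x v = 0" "F x v" for v
    proof -
      have "v \<notin> L"
        using that disj by auto
      then show ?thesis
        using that by (simp add: F_def)
    qed
    have LR: False if "l \<in> L" "x l = 0" "F x l" "r \<in> R" "x r = 0" "F x r" for l r
      using L[OF that(1-3)] R[OF that(4-6)] that by auto
    have LL: "l = l'" if "l \<in> L" "x l = 0" "F x l" "l' \<in> L" "x l' = 0" "F x l'" for l l'
    proof -
      \<comment> \<open>Both patterns are read at the coordinate \<open>h l\<close>, where the first
        one demands 1.\<close>
      have "h l = h l'"
        using bspec[OF L[OF that(1-3)] hR(1)[OF that(1)]]
          bspec[OF L[OF that(4-6)] hR(1)[OF that(1)]] by (cases "h l = h l'") simp_all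
      then show ?thesis
        using h that by (auto simp: bij_betw_def inj_on_def)
    qed
    have RR: "r = r'" if "r \<in> R" "x r = 0" "F x r" "r' \<in> R" "x r' = 0" "F x r'" for r r'
    proof -
      \<comment> \<open>At the preimage of \<open>r\<close> the pattern of \<open>r\<close> demands
        0, which that of \<open>r'\<close> allows only if \<open>r = r'\<close>.\<close>
      have "r \<in> h ` L"
        using h that(1) by (simp add: bij_betw_def)
      then obtain l where "l \<in> L" "h l = r"
        by auto
      then show ?thesis
        using R[OF that(1-3)] R[OF that(4-6)] by auto
    qed
    have "v = w" if "v \<in> ?V" "x v = 0" "F x v" "w \<in> ?V" "x w = 0" "F x w" for v w
      using that LL LR RR by (metis UnE)
    then have "card {v \<in> ?V. x v \<noteq> bool_network ?V F x v} \<le> Suc 0"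
      using fin zero by (subst card_le_Suc0_iff_eq) auto
    then show "card ?V - 1 \<le> card ?V - hamming_dist ?V x (bool_network ?V F x)"
      by (simp add: hamming_dist_def)
  qed (use fin in auto)
  ultimately show ?thesis
    by auto
qed

lemma ex_stable_monotone_network:
  assumes fin: "finite L" "finite R" and disj: "L \<inter> R = {}" and ne: "L \<noteq> {}"
    and card: "card L = m" "card R = m"
  shows "\<exists>f \<in> monotone_networks (looped_bipartite L R) 2. m \<le> stability (L \<union> R) 2 f"
proof -
  let ?V = "L \<union> R"
  define F :: "('a \<Rightarrow> nat) \<Rightarrow> 'a \<Rightarrow> bool" where
    "F x v \<longleftrightarrow> x v = 1 \<and> (if v \<in> L then \<forall>r\<in>R. x r = 1 else \<exists>l\<in>L. x l = 1)" for x v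
  have "bool_network (pverts (looped_bipartite L R)) F \<in> networks (looped_bipartite L R) 2"
  proof (rule bool_network_in_networks)
    fix x y :: "'a \<Rightarrow> nat" and v
    assume v: "v \<in> pverts (looped_bipartite L R)"
      and eq: "\<And>u. (u, v) \<in> parcs (looped_bipartite L R) \<Longrightarrow> x u = y u"
    have "x v = y v" "v \<in> L \<Longrightarrow> \<forall>r\<in>R. x r = y r" "v \<notin> L \<Longrightarrow> \<forall>l\<in>L. x l = y l"
      using v eq by auto
    then show "F x v = F y v"
      by (auto simp: F_def)
  next
    fix u v
    assume "(u, v) \<in> parcs (looped_bipartite L R)"
    then consider "v \<in> L" "u \<in> R \<or> u = v" | "v \<in> R" "u \<in> L" | "v \<in> R" "u = v"
      by auto
    then show "\<exists>x \<in> configs (pverts (looped_bipartite L R)) 2. F x v \<noteq> F (x(u := 1 - x u)) v"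
    proof cases
      case 1
      let ?x = "indicator_config ?V ?V"
      have "F ?x v" "\<not> F (?x(u := 1 - ?x u)) v"
        using 1 by (auto simp: F_def indicator_config_apply)
      then show ?thesis
        by (intro bexI[of _ ?x]) (auto simp: indicator_config_in_configs)
    next
      case 2
      \<comment> \<open>With \<open>L\<close> all zero, flipping \<open>u\<close> alone makes the
        disjunction true.\<close>
      let ?x = "indicator_config ?V R"
      have "v \<notin> L" "u \<notin> R"
        using 2 disj by auto
      then have "\<not> F ?x v" "F (?x(u := 1 - ?x u)) v"
        using 2 disj by (auto simp: F_def indicator_config_apply)
      then show ?thesis
        by (intro bexI[of _ ?x]) (auto simp: indicator_config_in_configs)
    next
      case 3
      let ?x = "indicator_config ?V ?V"
      have "v \<notin> L"
        using 3 disj by auto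
      then have "F ?x v" "\<not> F (?x(u := 1 - ?x u)) v"
        using 3 ne by (auto simp: F_def indicator_config_apply)
      then show ?thesis
        by (intro bexI[of _ ?x]) (auto simp: indicator_config_in_configs)
    qed
  qed auto
  moreover have "mono_on (configs ?V 2) (bool_network ?V F)"
  proof (intro mono_onI le_funI)
    fix x y :: "'a \<Rightarrow> nat" and v
    assume xy: "x \<in> configs ?V 2" "y \<in> configs ?V 2" "x \<le> y"
    have one: "y w = 1" if "w \<in> ?V" "x w = 1" for w
      using configs_2_cases[OF xy(2) that(1)] le_funD[OF xy(3), of w] that(2) by auto
    show "bool_network ?V F x v \<le> bool_network ?V F y v"
    proof (cases "v \<in> ?V")
      case True
      have "F y v" if "F x v"
        using that True one by (auto simp: F_def split: if_splits)
      then show ?thesis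
        using True xy by (simp add: bool_network_apply)
    qed (use xy in \<open>simp add: bool_network_def\<close>)
  qed
  moreover have "m \<le> stability ?V 2 (bool_network ?V F)"
  proof (rule stability_ge)
    fix x assume x: "x \<in> configs ?V 2"
    let ?D = "{v \<in> ?V. x v \<noteq> bool_network ?V F x v}"
    \<comment> \<open>The conjunct \<open>x v = 1\<close> in \<open>F\<close> means that the network
      only turns 1 into 0.\<close>
    have one: "x v = 1 \<and> \<not> F x v" if "v \<in> ?D" for v
    proof -
      have "v \<in> ?V" "x v \<noteq> of_bool (F x v)"
        using that x by (auto simp: bool_network_apply)
      then show ?thesis
        using configs_2_cases[OF x, of v] by (cases "F x v") (auto simp: F_def)
    qed
    have "?D \<subseteq> L \<or> ?D \<subseteq> R"
    proof (cases "\<exists>l\<in>L. x l = 1")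
      case True
      then have "v \<in> L" if "v \<in> ?D" for v
        using one[OF that] that by (auto simp: F_def split: if_splits)
      then show ?thesis by blast
    next
      case False
      then have "v \<in> R" if "v \<in> ?D" for v
        using one[OF that] that by auto
      then show ?thesis by blast
    qed
    then have "card ?D \<le> m"
      using fin card by (auto dest: card_mono[rotated])
    then show "m \<le> card ?V - hamming_dist ?V x (bool_network ?V F x)"
      using fin disj card by (simp add: hamming_dist_def card_Un_disjoint)
  qed (use fin in auto)
  ultimately show ?thesis
    by (auto simp: monotone_networks_def)
qed

section \<open>Upper bounds on stability\<close>

text \<open>Two configurations witnessing the arc agree at \<open>v\<close> but have different
  images there, so one of them is changed at \<open>v\<close>.\<close>

lemma stability_less_card:
  assumes fin: "finite V" and H: "pverts H = V" and f: "f \<in> networks H 2"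
    and uv: "(u, v) \<in> parcs H" "u \<noteq> v"
  shows "stability V 2 f < card V"
proof -
  have "(u, v) \<in> parcs (interaction_graph V 2 f)"
    using f uv H by (simp add: networks_def)
  then obtain x y where V: "v \<in> V" and xy: "x \<in> configs V 2" "y \<in> configs V 2"
    and d: "{w \<in> V. x w \<noteq> y w} = {u}" and ne: "f x v \<noteq> f y v"
    by (auto simp: interaction_graph_def)
  have "v \<notin> {w \<in> V. x w \<noteq> y w}"
    using d uv(2) by simp
  then have "x v = y v"
    using V by simp
  then obtain z where z: "z \<in> configs V 2" "z v \<noteq> f z v"
    using ne xy by metis
  have "0 < hamming_dist V z (f z)" "0 < card V"
    using V z fin unfolding hamming_dist_def by (auto simp: card_gt_0_iff)
  then show ?thesis
    using stability_le[OF fin z(1), of f] by linarith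
qed

text \<open>If a vertex of \<open>L\<close> keeps its value 1 at the indicator of \<open>L\<close>,
  then its value 0 at the indicator of \<open>R\<close> must change.\<close>

lemma monotone_changes:
  assumes fin: "finite L" "finite R" and disj: "L \<inter> R = {}" and ne: "R \<noteq> {}"
    and f: "f \<in> monotone_networks (looped_bipartite L R) 2" and v: "v \<in> L"
    and fixL: "f (indicator_config (L \<union> R) L) v = 1"
  shows "f (indicator_config (L \<union> R) R) v = 1"
proof (rule ccontr)
  let ?V = "L \<union> R"
  let ?a = "indicator_config ?V L" and ?b = "indicator_config ?V R"
  assume "f ?b v \<noteq> 1"
  have net: "f \<in> networks (looped_bipartite L R) 2" and mono: "mono_on (configs ?V 2) f"
    using f by (auto simp: monotone_networks_def)
  have fc: "f x \<in> configs ?V 2" if "x \<in> configs ?V 2" for x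
    using net that by (auto simp: networks_def)
  have b0: "f ?b v = 0"
    using configs_2_cases[OF fc, OF indicator_config_in_configs, of v R] v \<open>f ?b v \<noteq> 1\<close> by auto
  have id: "f x v = x v" if x: "x \<in> configs ?V 2" for x
  proof (cases "x v = 1")
    case True
    \<comment> \<open>Lies below \<open>x\<close> and agrees with \<open>?a\<close> at
      \<open>v\<close> and on \<open>R\<close>, so monotonicity forces \<open>f x v\<close> up to
      1.\<close>
    let ?z = "indicator_config ?V {w \<in> L. x w = 1}"
    have "f ?z v = f ?a v"
      using v True disj
      by (intro network_local[OF net])
        (auto simp: fin indicator_config_in_configs indicator_config_apply)
    moreover have "?z \<le> x"
      using x by (auto simp: le_fun_def indicator_config_def configs_def PiE_iff extensional_def)
    then have "f ?z v \<le> f x v"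
      by (rule le_funD[OF mono_onD[OF mono indicator_config_in_configs x]])
    ultimately show ?thesis
      using fixL True v configs_2_cases[OF fc[OF x], of v] by auto
  next
    case False
    then have x0: "x v = 0"
      using configs_2_cases[OF x, of v] v by auto
    \<comment> \<open>Lies above \<open>x\<close> and agrees with \<open>?b\<close> at
      \<open>v\<close> and on \<open>R\<close>, so monotonicity forces \<open>f x v\<close> down to
      0.\<close>
    let ?z = "indicator_config ?V {w \<in> ?V. w \<in> R \<or> x w = 1}"
    have "v \<notin> R"
      using v disj by auto
    then have "f ?z v = f ?b v"
      using v x0
      by (intro network_local[OF net])
        (auto simp: fin indicator_config_in_configs indicator_config_apply)
    moreover have "x \<le> ?z"
    proof (rule le_funI)
      fix w
      show "x w \<le> ?z w"
        using x configs_2_cases[OF x, of w]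
        by (cases "w \<in> ?V") (auto simp: indicator_config_def configs_def PiE_iff extensional_def)
    qed
    then have "f x v \<le> f ?z v"
      by (rule le_funD[OF mono_onD[OF mono x indicator_config_in_configs]])
    ultimately show ?thesis
      using b0 x0 by auto
  qed
  obtain r where r: "r \<in> R"
    using ne by auto
  then have "(r, v) \<in> parcs (interaction_graph ?V 2 f)"
    using net v by (auto simp: networks_def)
  then obtain x y where xy: "x \<in> configs ?V 2" "y \<in> configs ?V 2"
    and d: "{w \<in> ?V. x w \<noteq> y w} = {r}" and "f x v \<noteq> f y v"
    by (auto simp: interaction_graph_def)
  then have "x v \<noteq> y v"
    using id by simp
  then have "v \<in> {w \<in> ?V. x w \<noteq> y w}"
    using v by simp
  then have "v = r"
    unfolding d by simp
  then show False
    using r v disj by auto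
qed

lemma monotone_stability_le:
  assumes fin: "finite L" "finite R" and disj: "L \<inter> R = {}"
    and card: "card L = m" "card R = m" and m: "m \<ge> 1"
    and f: "f \<in> monotone_networks (looped_bipartite L R) 2"
  shows "stability (L \<union> R) 2 f \<le> m"
proof -
  let ?V = "L \<union> R"
  let ?a = "indicator_config ?V L" and ?b = "indicator_config ?V R"
  let ?D = "\<lambda>x. {v \<in> ?V. x v \<noteq> f x v}"
  have ne: "L \<noteq> {}" "R \<noteq> {}"
    using card m by auto
  have disj': "R \<inter> L = {}"
    using disj by blast
  \<comment> \<open>The graph is symmetric in its two sides, so \<open>monotone_changes\<close> also
    covers \<open>R\<close>.\<close>
  have f': "f \<in> monotone_networks (looped_bipartite R L) 2"
    using f by (simp add: looped_bipartite_commute)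
  have "v \<in> ?D ?a \<union> ?D ?b" if "v \<in> L" for v
    using monotone_changes[OF fin disj ne(2) f that] that disj
    by (auto simp: indicator_config_apply)
  moreover have "v \<in> ?D ?a \<union> ?D ?b" if "v \<in> R" for v
    using monotone_changes[OF fin(2,1) disj' ne(1) f' that] that disj
    by (auto simp: indicator_config_apply Un_commute[of R L])
  ultimately have "?V \<subseteq> ?D ?a \<union> ?D ?b"
    by blast
  then have "card ?V \<le> card (?D ?a \<union> ?D ?b)"
    using fin by (intro card_mono) auto
  also have "\<dots> \<le> card (?D ?a) + card (?D ?b)"
    by (rule card_Un_le)
  finally have "2 * m \<le> hamming_dist ?V ?a (f ?a) + hamming_dist ?V ?b (f ?b)"
    using fin disj card by (simp add: hamming_dist_def card_Un_disjoint)
  moreover have "stability ?V 2 f \<le> 2 * m - hamming_dist ?V x (f x)" if "x \<in> configs ?V 2" for x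
    using stability_le[of ?V x 2 f] fin disj card that by (simp add: card_Un_disjoint)
  from this[of ?a] this[of ?b]
  have "stability ?V 2 f \<le> 2 * m - hamming_dist ?V ?a (f ?a)"
    "stability ?V 2 f \<le> 2 * m - hamming_dist ?V ?b (f ?b)"
    by (auto simp: indicator_config_in_configs)
  ultimately show ?thesis
    by linarith
qed

theorem proposition3p12:
  fixes m :: nat and K :: "'v pair_pre_digraph"
  assumes "m \<ge> 1"
    and "complete_bipartite_digraph m m (with_proj K)"
  shows "max_stability (add_loops K) 2 = 2 * m - 1 \<and>
         max_monotone_stability (add_loops K) 2 = m"
proof -
  obtain L R where finV: "finite (pverts K)" and V: "pverts K = L \<union> R" and disj: "L \<inter> R = {}"
    and card: "card L = m" "card R = m" and arcs: "parcs K = L \<times> R \<union> R \<times> L"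
    using assms(2) unfolding complete_bipartite_digraph_pair_def by blast
  have fin: "finite L" "finite R"
    using finV V by auto
  have H: "add_loops K = looped_bipartite L R"
    using V arcs by (simp add: add_loops_def looped_bipartite_def)
  have cardV: "card (L \<union> R) = 2 * m"
    using fin disj card by (simp add: card_Un_disjoint)
  obtain l r where lr: "l \<in> L" "r \<in> R"
    using card assms(1) by fastforce
  then have arc: "(l, r) \<in> parcs (looped_bipartite L R)" "l \<noteq> r"
    using disj by auto
  \<comment> \<open>Finiteness is what makes \<open>Max\<close> an actual maximum.\<close>
  have finN: "finite (networks (looped_bipartite L R) 2)"
    using fin by (intro finite_networks) auto
  then have finM: "finite (monotone_networks (looped_bipartite L R) 2)"
    by (auto simp: monotone_networks_def)
  have upper: "stability (L \<union> R) 2 f \<le> 2 * m - 1" if "f \<in> networks (looped_bipartite L R) 2" for f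
    using stability_less_card[OF _ _ that arc, of "L \<union> R"] fin cardV by simp
  obtain h where "bij_betw h L R"
    using finite_same_card_bij[OF fin] card by auto
  then obtain f where f: "f \<in> networks (looped_bipartite L R) 2"
    "2 * m - 1 \<le> stability (L \<union> R) 2 f"
    using ex_stable_network[OF fin disj] cardV by auto
  have "max_stability (add_loops K) 2 = 2 * m - 1"
    unfolding max_stability_def H
    using finN upper f by (intro Max_eqI image_eqI[of _ _ f]) (auto intro: order_antisym)
  moreover obtain g where g: "g \<in> monotone_networks (looped_bipartite L R) 2"
    "m \<le> stability (L \<union> R) 2 g"
    using ex_stable_monotone_network[OF fin disj _ card] lr by auto
  have "max_monotone_stability (add_loops K) 2 = m"
    unfolding max_monotone_stability_def H
    using finM g monotone_stability_le[OF fin disj card assms(1)]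
    by (intro Max_eqI image_eqI[of _ _ g]) (auto intro: order_antisym)
  ultimately show ?thesis ..
qed

end
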